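(* Fix some positive integer $k$. If $p/q\in\mathbb{Q}\cap(0,1)$ with $\gcd\{p,q\}=1$ (and $q>0$), $x=[0;a_1,a_2,\dots]\in(0,1)\setminus\mathbb{Q}$ and \[\frac{k}{k+1}\le\Theta(x,p/q)<\frac{k+1}{k+2},\] then one of the following holds: \begin{enumerate} \item[(i)] $p/q$ is a regular continued fraction convergent of $x$ of the form $\frac pq=\frac{p_{j-1}}{q_{j-1}}$ for some $j$ such that $a_j=1$ and $a_{j+1}\ge k$, \item[(ii)] $p/q$ is a first mediant of $x$ of the form $\frac pq=\frac{p_j+p_{j-1}}{q_j+q_{j-1}}$ for some $j$ such that $a_{j+1}\le k+1$, or \item[(iii)] $p/q$ is a final mediant of $x$ of the form $\frac pq=\frac{(a_{j+1}-1)p_j+p_{j-1}}{(a_{j+1}-1)q_j+q_{j-1}}$ for some $j$ such that $a_{j+1}\le k+1$. \end{enumerate}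
   Context: For a real $x$ and a reduced fraction $p/q$ with $q>0$, $\Theta(x,p/q):=q|qx-p|$. $x=[0;a_1,a_2,\dots]$ denotes the regular continued fraction expansion of the irrational $x\in(0,1)$, with convergents $p_n/q_n=[0;a_1,\dots,a_n]$, $n\ge0$, in lowest terms, and $p_{-1}=1,q_{-1}=0$ (so $p_0=0,q_0=1$). The mediants of $x$ are the fractions $\frac{\lambda p_j+p_{j-1}}{\lambda q_j+q_{j-1}}$ with $j\ge0$ and $1\le\lambda<a_{j+1}$; the first mediants are those with $\lambda=1$ and the final mediants those with $\lambda=a_{j+1}-1$. *)

theory Defs
  imports Complex_Main
begin

text \<open>A fraction $p/q$ is passed as the pair \<open>p\<close>, \<open>q\<close>, which is meant to be reduced with \<open>q > 0\<close>.\<close>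

definition Theta :: "real \<Rightarrow> int \<Rightarrow> int \<Rightarrow> real"
  where "Theta x p q = of_int q * \<bar>of_int q * x - of_int p\<bar>"

definition gauss_map :: "real \<Rightarrow> real"
  where "gauss_map t = frac (1 / t)"

text \<open>The partial quotients $a_n$ of the regular continued fraction expansion
  $[0; a_1, a_2, \dots]$ of an irrational $x$ in $(0,1)$, with $a_0 = 0$.\<close>

fun cf_digit :: "real \<Rightarrow> nat \<Rightarrow> int"
  where
    "cf_digit x 0 = 0"
  | "cf_digit x (Suc n) = \<lfloor>1 / (gauss_map ^^ n) x\<rfloor>"

text \<open>\<open>cf_value [a\<^sub>0, \<dots>, a\<^sub>n]\<close> is the finite continued fraction $[a_0; a_1, \dots, a_n]$;
  the value at the empty list is a dummy.\<close>

fun cf_value :: "int list \<Rightarrow> rat"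
  where
    "cf_value [] = 0"
  | "cf_value [a] = of_int a"
  | "cf_value (a # b # bs) = of_int a + 1 / cf_value (b # bs)"

definition cf_convergent :: "real \<Rightarrow> nat \<Rightarrow> rat"
  where "cf_convergent x n = cf_value (map (cf_digit x) [0..<Suc n])"

text \<open>Numerator and denominator of the convergents in lowest terms, indexed by integers
  $n \ge -1$ so that $p_{-1} = 1$ and $q_{-1} = 0$ are included. Indices below $-1$ are
  never used.\<close>

definition cf_num :: "real \<Rightarrow> int \<Rightarrow> int"
  where "cf_num x n = (if n = -1 then 1 else fst (quotient_of (cf_convergent x (nat n))))"

definition cf_den :: "real \<Rightarrow> int \<Rightarrow> int"
  where "cf_den x n = (if n = -1 then 0 else snd (quotient_of (cf_convergent x (nat n))))"

text \<open>\<open>r\<close> is the mediant of \<open>x\<close> with parameters $j \ge 0$ and $1 \le \lambda < a_{j+1}$. In particular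
  there is neither a first nor a final mediant for \<open>j\<close> when $a_{j+1} = 1$.\<close>

definition is_mediant :: "real \<Rightarrow> nat \<Rightarrow> int \<Rightarrow> rat \<Rightarrow> bool"
  where "is_mediant x j l r \<longleftrightarrow> 1 \<le> l \<and> l < cf_digit x (j + 1) \<and>
    r = of_int (l * cf_num x (int j) + cf_num x (int j - 1)) /
        of_int (l * cf_den x (int j) + cf_den x (int j - 1))"

definition is_first_mediant :: "real \<Rightarrow> nat \<Rightarrow> rat \<Rightarrow> bool"
  where "is_first_mediant x j r \<longleftrightarrow> is_mediant x j 1 r"

definition is_final_mediant :: "real \<Rightarrow> nat \<Rightarrow> rat \<Rightarrow> bool"
  where "is_final_mediant x j r \<longleftrightarrow> is_mediant x j (cf_digit x (j + 1) - 1) r"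

end

theory Submission
  imports Defs
begin

text \<open>
  Write \<open>t\<^sub>m\<close> for the \<open>m\<close>-th iterate of \<open>x\<close> under the Gauss map, \<open>y = 1 / t\<^sub>m\<close> for the complete
  quotient, whose integer part is \<open>a = a\<^sub>m\<^sub>+\<^sub>1\<close>, and \<open>v = q\<^sub>m\<^sub>-\<^sub>1 / q\<^sub>m\<close>, which lies in \<open>[0, 1]\<close>.
  Two consecutive convergents form a basis of \<open>\<int>\<^sup>2\<close>, so every fraction is of the form
  \<open>(r p\<^sub>m + s p\<^sub>m\<^sub>-\<^sub>1) / (r q\<^sub>m + s q\<^sub>m\<^sub>-\<^sub>1)\<close>, and in these coordinates
  \[ \Theta = \frac{(r + s v)\,|s y - r|}{y + v} \]
  (lemma \<open>Theta_in_convergent_basis\<close>).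

  If \<open>m\<close> is chosen with \<open>q\<^sub>m \<le> q < q\<^sub>m\<^sub>+\<^sub>1\<close>, then \<open>1 \<le> r + s v < a + v\<close>, and the formula gives
  \<open>\<Theta> \<ge> 1\<close> as soon as \<open>s < 0\<close> or \<open>s > 1\<close>. For \<open>s = 0\<close> the fraction is a convergent, and for
  \<open>s = 1\<close> it is a mediant or the preceding convergent. This is the classification
  \<open>Theta_less_1_imp_convergent_or_mediant\<close>.

  It remains to evaluate the formula in these cases. For a convergent, \<open>\<Theta> = 1 / (y + v)\<close>, so
  \<open>\<Theta> \<ge> k / (k + 1)\<close> means \<open>y + v \<le> 1 + 1 / k\<close>; this forces \<open>a = 1\<close> and makes the next
  Gauss iterate at most \<open>1 / k\<close>, hence the next digit at least \<open>k\<close>. For a mediant,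
  \<open>1 / \<Theta> = 1 / (\<lambda> + v) + 1 / (y - \<lambda>)\<close>. If both denominators are at least \<open>2\<close> then
  \<open>\<Theta> \<ge> 1\<close>; hence \<open>\<lambda>\<close> is \<open>1\<close> or \<open>a - 1\<close>. In either case one denominator is at least \<open>1\<close> and
  the other at least \<open>a - 1\<close>, so \<open>a \<ge> k + 2\<close> would give \<open>\<Theta> \<ge> (k + 1) / (k + 2)\<close>.
\<close>

section \<open>Monotonicity of the half harmonic mean\<close>

text \<open>The approximation coefficient of a mediant has the form \<open>A B / (A + B)\<close>, the inverse of
  \<open>1 / A + 1 / B\<close>. Monotonicity reduces its estimates to integral values of \<open>A\<close> and \<open>B\<close>.\<close>

lemma half_harmonic_mean_mono:
  fixes A B C D :: real
  assumes "0 < C" "0 < D" "C \<le> A" "D \<le> B"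
  shows "C * D / (C + D) \<le> A * B / (A + B)"
proof -
  have "1 / A + 1 / B \<le> 1 / C + 1 / D"
    using assms by (intro add_mono divide_left_mono mult_pos_pos) auto
  then have "1 / (1 / C + 1 / D) \<le> 1 / (1 / A + 1 / B)"
    using assms by (intro divide_left_mono mult_pos_pos add_pos_pos) auto
  moreover have "1 / (1 / C + 1 / D) = C * D / (C + D)" "1 / (1 / A + 1 / B) = A * B / (A + B)"
    using assms by (auto simp: field_simps)
  ultimately show ?thesis
    by simp
qed

section \<open>Continuants of finite continued fractions\<close>

text \<open>The values at the empty list are those of the convergent with index \<open>-1\<close>, so that the
  recurrence below holds from the start.\<close>

fun continuant_num :: "int list \<Rightarrow> int" and continuant_den :: "int list \<Rightarrow> int"
  where
    "continuant_num [] = 1"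
  | "continuant_num (a # as) = a * continuant_num as + continuant_den as"
  | "continuant_den [] = 0"
  | "continuant_den (a # as) = continuant_num as"

text \<open>The continuants are defined by extending a list at its front, as continued fractions are;
  the sequence of convergents extends it at its end.\<close>

lemma continuant_snoc:
  "continuant_num (as @ [a, b]) = b * continuant_num (as @ [a]) + continuant_num as"
  "continuant_den (as @ [a, b]) = b * continuant_den (as @ [a]) + continuant_den as"
proof -
  have "continuant_num (as @ [a, b]) = b * continuant_num (as @ [a]) + continuant_num as \<and>
        continuant_den (as @ [a, b]) = b * continuant_den (as @ [a]) + continuant_den as"
    by (induction as) (auto simp: algebra_simps)
  then show "continuant_num (as @ [a, b]) = b * continuant_num (as @ [a]) + continuant_num as"
    "continuant_den (as @ [a, b]) = b * continuant_den (as @ [a]) + continuant_den as"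
    by auto
qed

lemma continuant_nonneg:
  assumes "\<And>b. b \<in> set as \<Longrightarrow> b \<ge> 1"
  shows "continuant_num as \<ge> 1 \<and> continuant_den as \<ge> 0"
  using assms
proof (induction as)
  case (Cons a as)
  then have "continuant_num as \<ge> 1" "continuant_den as \<ge> 0" "a \<ge> 1"
    by auto
  moreover from this have "a * continuant_num as \<ge> 1 * 1"
    by (intro mult_mono) auto
  ultimately show ?case
    by auto
qed auto

lemma cf_value_eq_continuants:
  assumes "\<And>b. b \<in> set as \<Longrightarrow> b \<ge> 1"
  shows "cf_value (a # as) = of_int (continuant_num (a # as)) / of_int (continuant_den (a # as))"
  using assms
proof (induction as arbitrary: a)
  case (Cons b bs)
  have pos: "continuant_num (b # bs) \<ge> 1" "continuant_num bs \<ge> 1"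
    using Cons.prems continuant_nonneg[of "b # bs"] continuant_nonneg[of bs] by auto
  have "cf_value (a # b # bs) = of_int a + 1 / cf_value (b # bs)"
    by simp
  also have "cf_value (b # bs) = of_int (continuant_num (b # bs)) / of_int (continuant_num bs)"
    using Cons by auto
  also have "of_int a + 1 / (of_int (continuant_num (b # bs)) / of_int (continuant_num bs)) =
      (of_int (a * continuant_num (b # bs) + continuant_num bs) / of_int (continuant_num (b # bs)) :: rat)"
  proof -
    have "of_int a + 1 / (of_int M / of_int N) = (of_int (a * M + N) / of_int M :: rat)"
      if "M \<noteq> 0" for M N :: int
      using that by (simp add: add_divide_distrib)
    then show ?thesis
      using pos by (metis not_one_le_zero)
  qed
  finally show ?case
    by simp
qed simp

section \<open>Convergents of an irrational number\<close>

text \<open>The index is shifted by one: \<open>conv_num x m\<close> and \<open>conv_den x m\<close> are \<open>p\<^sub>m\<^sub>-\<^sub>1\<close> and \<open>q\<^sub>m\<^sub>-\<^sub>1\<close>.\<close>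

definition conv_num :: "real \<Rightarrow> nat \<Rightarrow> int"
  where "conv_num x m = continuant_num (map (cf_digit x) [0..<m])"

definition conv_den :: "real \<Rightarrow> nat \<Rightarrow> int"
  where "conv_den x m = continuant_den (map (cf_digit x) [0..<m])"

lemma conv_simps [simp]:
  "conv_num x 0 = 1" "conv_den x 0 = 0" "conv_num x (Suc 0) = 0" "conv_den x (Suc 0) = 1"
  by (auto simp: conv_num_def conv_den_def)

lemma conv_num_rec: "conv_num x (Suc (Suc m)) = cf_digit x (Suc m) * conv_num x (Suc m) + conv_num x m"
  and conv_den_rec: "conv_den x (Suc (Suc m)) = cf_digit x (Suc m) * conv_den x (Suc m) + conv_den x m"
  using continuant_snoc[of "map (cf_digit x) [0..<m]" "cf_digit x m" "cf_digit x (Suc m)"]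
  by (simp_all add: conv_num_def conv_den_def)

lemma conv_det: "conv_num x (Suc m) * conv_den x m - conv_num x m * conv_den x (Suc m) = (-1) ^ Suc m"
  by (induction m) (simp_all add: conv_num_rec conv_den_rec algebra_simps)

lemma conv_coprime: "coprime (conv_num x m) (conv_den x m)"
proof (rule coprimeI)
  fix c assume c: "c dvd conv_num x m" "c dvd conv_den x m"
  then have "c dvd conv_num x (Suc m) * conv_den x m - conv_num x m * conv_den x (Suc m)"
    by simp
  then show "is_unit c"
    unfolding conv_det by (rule dvd_trans) (simp add: is_unit_power_iff)
qed

locale irrational_cf =
  fixes x :: real
  assumes x_pos: "0 < x" and x_less_1: "x < 1" and x_irrational: "x \<notin> \<rat>"
begin

abbreviation gauss_iter :: "nat \<Rightarrow> real"
  where "gauss_iter m \<equiv> (gauss_map ^^ m) x"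

lemma gauss_iter_irrational: "gauss_iter m \<notin> \<rat>"
proof (induction m)
  case (Suc m)
  show ?case
  proof
    assume "gauss_iter (Suc m) \<in> \<rat>"
    then have "gauss_iter (Suc m) + of_int \<lfloor>1 / gauss_iter m\<rfloor> \<in> \<rat>"
      by simp
    then have "inverse (1 / gauss_iter m) \<in> \<rat>"
      unfolding gauss_map_def by (intro Rats_inverse) (simp add: gauss_map_def frac_def)
    with Suc show False
      by simp
  qed
qed (simp add: x_irrational)

lemma gauss_iter_bounds: "0 < gauss_iter m" "gauss_iter m < 1"
proof -
  have "gauss_iter m \<noteq> 0"
    using gauss_iter_irrational[of m] by (metis Rats_0)
  moreover have "0 \<le> gauss_iter m \<and> gauss_iter m < 1"
    using x_pos x_less_1 by (cases m) (auto simp: gauss_map_def frac_lt_1)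
  ultimately show "0 < gauss_iter m" "gauss_iter m < 1"
    by auto
qed

lemma complete_quotient_eq: "1 / gauss_iter m = of_int (cf_digit x (Suc m)) + gauss_iter (Suc m)"
  by (simp add: gauss_map_def frac_def)

lemma cf_digit_ge_1: "cf_digit x (Suc m) \<ge> 1"
  using gauss_iter_bounds[of m] by (simp add: le_floor_iff)

lemma conv_den_Suc_pos: "conv_den x (Suc m) \<ge> 1" and conv_den_nonneg: "conv_den x m \<ge> 0"
proof -
  have "conv_den x (Suc m) \<ge> 1 \<and> conv_den x m \<ge> 0"
  proof (induction m)
    case (Suc m)
    have "cf_digit x (Suc m) * conv_den x (Suc m) \<ge> 1 * 1"
      using Suc cf_digit_ge_1[of m] by (intro mult_mono) linarith+
    with Suc show ?case
      by (simp add: conv_den_rec)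
  qed simp
  then show "conv_den x (Suc m) \<ge> 1" "conv_den x m \<ge> 0"
    by auto
qed

lemma conv_den_growth: "conv_den x (Suc (Suc m)) \<ge> conv_den x (Suc m) + conv_den x m"
proof -
  have "cf_digit x (Suc m) * conv_den x (Suc m) \<ge> 1 * conv_den x (Suc m)"
    using cf_digit_ge_1[of m] conv_den_Suc_pos[of m] by (intro mult_right_mono) auto
  then show ?thesis
    by (simp add: conv_den_rec)
qed

lemma conv_den_mono: "conv_den x m \<le> conv_den x (Suc m)"
  using conv_den_growth[of "m - 1"] conv_den_nonneg[of "m - 1"] by (cases m) auto

lemma conv_den_unbounded: "conv_den x (Suc m) \<ge> int m"
proof (induction m)
  case (Suc m)
  then show ?case
    using conv_den_growth[of m] conv_den_Suc_pos[of "m - 1"] conv_den_Suc_pos[of "Suc m"]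
    by (cases m) auto
qed simp

text \<open>The tail of the digit list consists of positive integers, and coprimality of the
  continuants makes them the reduced form of the convergent.\<close>

lemma cf_num_den_eq:
  "cf_num x (int j - 1) = conv_num x j" "cf_den x (int j - 1) = conv_den x j"
proof -
  have "cf_num x (int j - 1) = conv_num x j \<and> cf_den x (int j - 1) = conv_den x j"
  proof (cases j)
    case 0
    then show ?thesis
      by (simp add: cf_num_def cf_den_def)
  next
    case (Suc n)
    have split: "map (cf_digit x) [0..<Suc n] = 0 # map (cf_digit x) [1..<Suc n]"
      by (simp add: upt_conv_Cons del: upt_Suc)
    have "b \<ge> 1" if b: "b \<in> set (map (cf_digit x) [1..<Suc n])" for b
    proof -
      obtain i where i: "i \<ge> 1" "b = cf_digit x i"
        using b by auto
      then show ?thesis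
        using cf_digit_ge_1[of "i - 1"] by simp
    qed
    then have "cf_convergent x n = of_int (conv_num x j) / of_int (conv_den x j)"
      unfolding cf_convergent_def conv_num_def conv_den_def Suc split
      by (rule cf_value_eq_continuants)
    then have "quotient_of (cf_convergent x n) = Rat.normalize (conv_num x j, conv_den x j)"
      by (simp only: quotient_of_Fract flip: Fract_of_int_quotient)
    also have "\<dots> = (conv_num x j, conv_den x j)"
      using conv_den_Suc_pos[of n] Suc conv_coprime[of x j] by (intro normalize_stable) auto
    finally show ?thesis
      by (simp add: cf_num_def cf_den_def Suc)
  qed
  then show "cf_num x (int j - 1) = conv_num x j" "cf_den x (int j - 1) = conv_den x j"
    by auto
qed

section \<open>Approximation coefficients in the basis of two consecutive convergents\<close>

definition conv_err :: "nat \<Rightarrow> real"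
  where "conv_err m = of_int (conv_den x m) * x - of_int (conv_num x m)"

lemma conv_err_Suc: "conv_err (Suc m) = - gauss_iter m * conv_err m"
proof (induction m)
  case (Suc m)
  have t: "gauss_iter m \<noteq> 0"
    using gauss_iter_bounds(1)[of m] by simp
  have "conv_err (Suc (Suc m)) = of_int (cf_digit x (Suc m)) * conv_err (Suc m) + conv_err m"
    by (simp add: conv_err_def conv_num_rec conv_den_rec algebra_simps)
  also have "conv_err m = - (1 / gauss_iter m) * conv_err (Suc m)"
    using Suc t by simp
  also have "of_int (cf_digit x (Suc m)) * conv_err (Suc m) + - (1 / gauss_iter m) * conv_err (Suc m)
      = - gauss_iter (Suc m) * conv_err (Suc m)"
    unfolding complete_quotient_eq by (simp add: algebra_simps)
  finally show ?case .
qed (simp add: conv_err_def)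

text \<open>This is the determinant of two consecutive convergents, rewritten with the errors.\<close>

lemma abs_conv_err: "\<bar>conv_err m\<bar> * (of_int (conv_den x (Suc m)) + gauss_iter m * of_int (conv_den x m)) = 1"
proof -
  let ?d = "\<lambda>m. real_of_int (conv_den x m)" and ?n = "\<lambda>m. real_of_int (conv_num x m)"
  have "conv_err m * (?d (Suc m) + gauss_iter m * ?d m) = conv_err m * ?d (Suc m) - conv_err (Suc m) * ?d m"
    by (simp add: conv_err_Suc algebra_simps)
  also have "\<dots> = ?n (Suc m) * ?d m - ?n m * ?d (Suc m)"
    by (simp add: conv_err_def algebra_simps)
  also have "\<dots> = of_int ((-1) ^ Suc m)"
    by (simp only: flip: conv_det[of x m]) simp
  finally have "\<bar>conv_err m * (?d (Suc m) + gauss_iter m * ?d m)\<bar> = 1"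
    by simp
  moreover have "?d (Suc m) + gauss_iter m * ?d m \<ge> 0"
    using conv_den_nonneg gauss_iter_bounds(1)[of m] by (intro add_nonneg_nonneg mult_nonneg_nonneg) auto
  ultimately show ?thesis
    by (simp add: abs_mult)
qed

definition den_ratio :: "nat \<Rightarrow> real"
  where "den_ratio m = of_int (conv_den x m) / of_int (conv_den x (Suc m))"

lemma den_ratio_bounds: "0 \<le> den_ratio m" "den_ratio m \<le> 1"
  using conv_den_nonneg[of m] conv_den_Suc_pos[of m] conv_den_mono[of m]
  by (auto simp: den_ratio_def)

lemma Theta_in_convergent_basis:
  fixes r s :: int and m :: nat
  defines "y \<equiv> 1 / gauss_iter m" and "v \<equiv> den_ratio m"
  shows "Theta x (r * conv_num x (Suc m) + s * conv_num x m) (r * conv_den x (Suc m) + s * conv_den x m)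
    = (of_int r + of_int s * v) * \<bar>of_int s * y - of_int r\<bar> / (y + v)"
proof -
  define t where "t = gauss_iter m"
  define d d' :: real where "d = of_int (conv_den x m)" and "d' = of_int (conv_den x (Suc m))"
  have t: "0 < t" and y: "y = 1 / t"
    using gauss_iter_bounds(1) by (auto simp: t_def y_def)
  have d: "0 \<le> d" "0 < d'"
    using conv_den_nonneg[of m] conv_den_Suc_pos[of m] by (auto simp: d_def d'_def)
  have v: "v = d / d'"
    by (simp add: v_def den_ratio_def d_def d'_def)
  have pos: "d' + t * d > 0"
    using d t by (simp add: add_pos_nonneg)
  have err: "\<bar>conv_err m\<bar> = 1 / (d' + t * d)"
    using abs_conv_err[of m] pos by (simp add: t_def d_def d'_def field_simps)
  have "of_int (r * conv_den x (Suc m) + s * conv_den x m) * x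
      - of_int (r * conv_num x (Suc m) + s * conv_num x m) = of_int r * conv_err (Suc m) + of_int s * conv_err m"
    by (simp add: conv_err_def algebra_simps)
  also have "\<dots> = conv_err m * (t * (of_int s * y - of_int r))"
    using t by (simp add: conv_err_Suc y t_def[symmetric] algebra_simps)
  finally have "Theta x (r * conv_num x (Suc m) + s * conv_num x m) (r * conv_den x (Suc m) + s * conv_den x m)
      = (of_int r * d' + of_int s * d) * (\<bar>conv_err m\<bar> * (t * \<bar>of_int s * y - of_int r\<bar>))"
    using t by (simp add: Theta_def d_def d'_def abs_mult)
  also have "\<dots> = (of_int r + of_int s * v) * d' * (t * \<bar>of_int s * y - of_int r\<bar>) / (d' + t * d)"
  proof -
    have "of_int r * d' + of_int s * d = (of_int r + of_int s * v) * d'"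
      using d by (simp add: v field_simps)
    then show ?thesis
      by (simp add: err)
  qed
  also have "d' + t * d = d' * t * (y + v)"
    using d t by (simp add: y v field_simps)
  finally show ?thesis
    using d t by simp
qed

section \<open>Fractions with approximation coefficient below one\<close>

lemma exists_den_bracket:
  assumes "q > 0"
  obtains m where "conv_den x (Suc m) \<le> q" "q < conv_den x (Suc (Suc m))"
proof -
  have "\<exists>n. q < conv_den x (Suc n)"
    using conv_den_unbounded[of "nat q + 1"] assms by (intro exI[of _ "nat q + 1"]) linarith
  then have L: "q < conv_den x (Suc (LEAST n. q < conv_den x (Suc n)))"
    by (rule LeastI_ex)
  obtain m where m: "(LEAST n. q < conv_den x (Suc n)) = Suc m"
    using L assms by (cases "LEAST n. q < conv_den x (Suc n)") auto
  then have "\<not> q < conv_den x (Suc m)"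
    by (metis lessI not_less_Least)
  moreover have "q < conv_den x (Suc (Suc m))"
    using L m by simp
  ultimately show ?thesis
    using that[of m] by simp
qed

lemma convergent_basis_coordinates:
  obtains r s where "p = r * conv_num x (Suc m) + s * conv_num x m"
    "q = r * conv_den x (Suc m) + s * conv_den x m"
proof -
  define e :: int where "e = (-1) ^ Suc m"
  have e: "e * e = 1"
    by (simp add: e_def flip: power_add)
  have det: "conv_num x (Suc m) * conv_den x m - conv_num x m * conv_den x (Suc m) = e"
    by (simp only: conv_det e_def)
  \<comment> \<open>Cramer's rule, with the determinant its own inverse.\<close>
  let ?r = "e * (p * conv_den x m - q * conv_num x m)"
  let ?s = "e * (q * conv_num x (Suc m) - p * conv_den x (Suc m))"
  have "?r * conv_num x (Suc m) + ?s * conv_num x m = e * e * p"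
    by (subst (3) det[symmetric]) (simp add: algebra_simps)
  moreover have "?r * conv_den x (Suc m) + ?s * conv_den x m = e * e * q"
    by (subst (3) det[symmetric]) (simp add: algebra_simps)
  ultimately show ?thesis
    using that[of ?r ?s] e by simp
qed

text \<open>With \<open>w = r + s v\<close> one has \<open>s y - r = s (y + v) - w\<close>. Since \<open>0 < w < y + v\<close>, this exceeds
  \<open>y + v\<close> if \<open>s \<ge> 2\<close>, and lies below \<open>- (y + v)\<close> if \<open>s \<le> -1\<close>. Its other factor \<open>w\<close> being at least
  \<open>1\<close>, the approximation coefficient cannot be smaller than \<open>1\<close> in either case.\<close>

lemma second_coordinate_0_or_1:
  fixes r s :: int and v y :: real
  assumes v: "0 \<le> v" and y: "1 < y"
    and w: "1 \<le> of_int r + of_int s * v" "of_int r + of_int s * v < y + v"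
    and Theta: "(of_int r + of_int s * v) * \<bar>of_int s * y - of_int r\<bar> / (y + v) < 1"
  shows "s = 0 \<or> s = 1"
proof (rule ccontr)
  assume "\<not> (s = 0 \<or> s = 1)"
  then consider "s \<le> -1" | "s \<ge> 2"
    by linarith
  then have "y + v \<le> \<bar>of_int s * y - of_int r\<bar>"
  proof cases
    case 1
    then have "of_int s * (y + v) \<le> -1 * (y + v)"
      using v y by (intro mult_right_mono) auto
    then have "y + v \<le> - (of_int s * y - of_int r)"
      using w(1) by (simp add: distrib_left)
    then show ?thesis
      by simp
  next
    case 2
    then have "2 * (y + v) \<le> of_int s * (y + v)"
      using v y by (intro mult_right_mono) auto
    then have "y + v \<le> of_int s * y - of_int r"
      using w(2) by (simp add: distrib_left)
    then show ?thesis
      by simp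
  qed
  then have "1 * (y + v) \<le> (of_int r + of_int s * v) * \<bar>of_int s * y - of_int r\<bar>"
    using w(1) v y by (intro mult_mono) auto
  with Theta v y show False
    by simp
qed

text \<open>Comparing \<open>q\<close> with the denominators of the convergents selects a basis in which the first
  coordinate \<open>r\<close> satisfies \<open>0 \<le> r < a\<close> once the second is \<open>1\<close>; if the second is \<open>0\<close>, coprimality
  leaves only the basis vector itself.\<close>

lemma Theta_less_1_imp_convergent_or_mediant:
  assumes q: "q > 0" and coprime: "coprime p q" and Theta: "Theta x p q < 1"
  shows "(\<exists>m. p = conv_num x (Suc m) \<and> q = conv_den x (Suc m)) \<or>
    (\<exists>m l. 1 \<le> l \<and> l < cf_digit x (Suc m) \<and>
      p = l * conv_num x (Suc m) + conv_num x m \<and> q = l * conv_den x (Suc m) + conv_den x m)"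
proof -
  obtain m where m: "conv_den x (Suc m) \<le> q" "q < conv_den x (Suc (Suc m))"
    using exists_den_bracket[OF q] .
  obtain r s where p_eq: "p = r * conv_num x (Suc m) + s * conv_num x m"
    and q_eq: "q = r * conv_den x (Suc m) + s * conv_den x m"
    using convergent_basis_coordinates .
  define y where "y = 1 / gauss_iter m"
  define v where "v = den_ratio m"
  note v = den_ratio_bounds[of m, folded v_def]
  have y: "1 < y" "of_int (cf_digit x (Suc m)) < y"
    using gauss_iter_bounds[of m] gauss_iter_bounds(1)[of "Suc m"] complete_quotient_eq[of m]
    by (auto simp: y_def)
  have den_pos: "real_of_int (conv_den x (Suc m)) > 0"
    using conv_den_Suc_pos[of m] by linarith
  have w: "of_int r + of_int s * v = real_of_int q / real_of_int (conv_den x (Suc m))"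
    using den_pos by (simp add: q_eq v_def den_ratio_def field_simps)
  have w_ge: "1 \<le> of_int r + of_int s * v"
    unfolding w using m(1) den_pos by simp
  have "real_of_int q / real_of_int (conv_den x (Suc m))
      < real_of_int (conv_den x (Suc (Suc m))) / real_of_int (conv_den x (Suc m))"
    using m(2) den_pos by (intro divide_strict_right_mono) auto
  also have "\<dots> = of_int (cf_digit x (Suc m)) + v"
    using den_pos by (simp add: conv_den_rec v_def den_ratio_def add_divide_distrib)
  finally have w_less: "of_int r + of_int s * v < of_int (cf_digit x (Suc m)) + v"
    unfolding w .
  have "s = 0 \<or> s = 1"
  proof (rule second_coordinate_0_or_1[OF v(1) y(1) w_ge])
    show "(of_int r + of_int s * v) * \<bar>of_int s * y - of_int r\<bar> / (y + v) < 1"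
      using Theta unfolding p_eq q_eq Theta_in_convergent_basis y_def v_def .
  qed (use w_less y in linarith)
  then show ?thesis
  proof
    assume s: "s = 0"
    then have "r dvd p" "r dvd q"
      using p_eq q_eq by auto
    then have "is_unit r"
      using coprime coprime_common_divisor by blast
    with w_ge s have "r = 1"
      by auto
    with s p_eq q_eq show ?thesis
      by auto
  next
    assume s: "s = 1"
    have r: "r < cf_digit x (Suc m)" "r \<ge> 0"
      using w_less w_ge v s by auto
    show ?thesis
    proof (cases "r = 0")
      case True
      \<comment> \<open>This happens only for \<open>q\<^sub>m = q\<^sub>m\<^sub>-\<^sub>1\<close>, that is, \<open>m = 1\<close> and \<open>a\<^sub>1 = 1\<close>.\<close>
      have "m \<noteq> 0"
        using True s q_eq q by (cases m) auto
      then obtain n where "m = Suc n"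
        by (cases m) auto
      then show ?thesis
        using True s p_eq q_eq by auto
    next
      case False
      then have "1 \<le> r \<and> r < cf_digit x (Suc m)"
        using r by simp
      with s p_eq q_eq show ?thesis
        by (intro disjI2 exI[of _ m] exI[of _ r]) auto
    qed
  qed
qed

section \<open>Digits from the approximation coefficient\<close>

lemma convergent_digits:
  fixes k :: nat
  assumes k: "k > 0"
    and Theta: "real k / (real k + 1) \<le> Theta x (conv_num x (Suc m)) (conv_den x (Suc m))"
  shows "cf_digit x (Suc m) = 1 \<and> cf_digit x (Suc (Suc m)) \<ge> int k"
proof -
  define y where "y = 1 / gauss_iter m"
  define t where "t = gauss_iter (Suc m)"
  define a where "a = cf_digit x (Suc m)"
  have y: "y = of_int a + t" "1 < y"
    using gauss_iter_bounds[of m] complete_quotient_eq[of m] by (auto simp: y_def a_def t_def)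
  have t: "0 < t" "t < 1"
    using gauss_iter_bounds[of "Suc m"] by (auto simp: t_def)
  have a: "a \<ge> 1"
    using cf_digit_ge_1 by (simp add: a_def)
  have v: "0 \<le> den_ratio m"
    by (rule den_ratio_bounds)
  have "Theta x (conv_num x (Suc m)) (conv_den x (Suc m)) = 1 / (y + den_ratio m)"
    using Theta_in_convergent_basis[of 1 m 0] by (simp add: y_def)
  with Theta have "real k / (real k + 1) \<le> 1 / (y + den_ratio m)"
    by simp
  then have "real k * (y + den_ratio m) \<le> real k + 1"
    using v y(2) by (simp add: field_simps)
  moreover have "real k * den_ratio m \<ge> 0"
    using v by simp
  ultimately have "real k * y \<le> real k + 1"
    by (simp add: algebra_simps)
  then have le: "real k * (of_int a - 1) + real k * t \<le> 1"
    by (simp add: y algebra_simps)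
  have kt: "real k * t > 0"
    using k t by simp
  have "a < 2"
  proof (rule ccontr)
    assume "\<not> a < 2"
    then have "1 * 1 \<le> real k * (of_int a - 1)"
      using k by (intro mult_mono) auto
    with le kt show False
      by simp
  qed
  with a have a1: "a = 1"
    by simp
  with le have "real k * t \<le> 1"
    by simp
  then have "real k \<le> 1 / t"
    using t by (simp add: field_simps)
  then have "int k \<le> \<lfloor>1 / t\<rfloor>"
    by (simp add: le_floor_iff)
  with a1 show ?thesis
    by (simp add: a_def t_def)
qed

lemma mediant_digits:
  fixes k :: nat and l :: int
  assumes l: "1 \<le> l" "l < cf_digit x (Suc m)"
    and Theta: "Theta x (l * conv_num x (Suc m) + conv_num x m) (l * conv_den x (Suc m) + conv_den x m)
      < (real k + 1) / (real k + 2)"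
  shows "(l = 1 \<or> l = cf_digit x (Suc m) - 1) \<and> cf_digit x (Suc m) \<le> int k + 1"
proof -
  define a where "a = cf_digit x (Suc m)"
  define A where "A = of_int l + den_ratio m"
  define B where "B = 1 / gauss_iter m - of_int l"
  have A: "of_int l \<le> A"
    using den_ratio_bounds by (simp add: A_def)
  have B: "of_int (a - l) \<le> B"
    using gauss_iter_bounds(1)[of "Suc m"] complete_quotient_eq[of m] by (simp add: a_def B_def)
  have "0 < B"
    using B l by (simp add: a_def)
  then have "Theta x (l * conv_num x (Suc m) + conv_num x m) (l * conv_den x (Suc m) + conv_den x m)
      = A * B / (A + B)"
    using Theta_in_convergent_basis[of l m 1] by (simp add: A_def B_def add.commute)
  with Theta have AB: "A * B / (A + B) < (real k + 1) / (real k + 2)"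
    by simp
  have ends: "l = 1 \<or> l = a - 1"
  proof (rule ccontr)
    assume "\<not> (l = 1 \<or> l = a - 1)"
    then have "2 \<le> l" "2 \<le> a - l"
      using l by (auto simp: a_def)
    then have "2 \<le> A" "2 \<le> B"
      using A B by linarith+
    then have "2 * 2 / (2 + 2) \<le> A * B / (A + B)"
      by (intro half_harmonic_mean_mono) auto
    moreover have "(real k + 1) / (real k + 2) < 1"
      by simp
    ultimately show False
      using AB by simp
  qed
  have "a \<le> int k + 1"
  proof (rule ccontr)
    assume "\<not> a \<le> int k + 1"
    then have "1 \<le> A \<and> real k + 1 \<le> B \<or> real k + 1 \<le> A \<and> 1 \<le> B"
      using ends A B by auto
    then have "(real k + 1) / (real k + 2) \<le> A * B / (A + B)"
      using half_harmonic_mean_mono[of 1 "real k + 1" A B] half_harmonic_mean_mono[of "real k + 1" 1 A B]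
      by (auto simp: add.commute)
    with AB show False
      by simp
  qed
  with ends show ?thesis
    by (simp add: a_def)
qed

end

theorem theorem5p21:
  fixes k :: nat and p q :: int and x :: real
  assumes "k > 0"
    and "q > 0" and "gcd p q = 1"
    and "0 < (of_int p / of_int q :: rat)" and "(of_int p / of_int q :: rat) < 1"
    and "0 < x" and "x < 1" and "x \<notin> \<rat>"
    and "real k / (real k + 1) \<le> Theta x p q"
    and "Theta x p q < (real k + 1) / (real k + 2)"
  shows "(\<exists>j\<ge>1. (of_int p / of_int q :: rat)
              = of_int (cf_num x (int j - 1)) / of_int (cf_den x (int j - 1)) \<and>
            cf_digit x j = 1 \<and> cf_digit x (j + 1) \<ge> int k)
       \<or> (\<exists>j. is_first_mediant x j (of_int p / of_int q) \<and> cf_digit x (j + 1) \<le> int k + 1)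
       \<or> (\<exists>j. is_final_mediant x j (of_int p / of_int q) \<and> cf_digit x (j + 1) \<le> int k + 1)"
proof -
  interpret irrational_cf x
    using assms by unfold_locales auto
  have "Theta x p q < 1"
    using assms(10) by (rule order.strict_trans) simp
  moreover have "coprime p q"
    using assms(3) by (simp add: coprime_iff_gcd_eq_1)
  ultimately consider
    (convergent) m where "p = conv_num x (Suc m)" "q = conv_den x (Suc m)"
  | (mediant) m l where "1 \<le> l" "l < cf_digit x (Suc m)"
      "p = l * conv_num x (Suc m) + conv_num x m" "q = l * conv_den x (Suc m) + conv_den x m"
    using Theta_less_1_imp_convergent_or_mediant[OF assms(2)] by blast
  then show ?thesis
  proof cases
    case convergent
    then have "cf_digit x (Suc m) = 1 \<and> cf_digit x (Suc (Suc m)) \<ge> int k"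
      using convergent_digits[OF assms(1)] assms(9) by simp
    then show ?thesis
      unfolding cf_num_den_eq using convergent by (intro disjI1 exI[of _ "Suc m"]) auto
  next
    case mediant
    then have digits: "(l = 1 \<or> l = cf_digit x (Suc m) - 1) \<and> cf_digit x (Suc m) \<le> int k + 1"
      using mediant_digits assms(10) by blast
    have "is_mediant x m l (of_int p / of_int q)"
      unfolding is_mediant_def cf_num_den_eq
      using mediant cf_num_den_eq[of "Suc m"] by simp
    with digits show ?thesis
      unfolding is_first_mediant_def is_final_mediant_def by (metis Suc_eq_plus1)
  qed
qed

end
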